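(* \textsc{Dilation $2$-Augmentation} is polynomial-time solvable when $\Gamma$ is a tree (and $G$ is an arbitrary graph).
   Context: Let $\Gamma$ be a finite undirected unweighted graph with vertex set $V$, and let $d_\Gamma(u,v)$ denote the shortest-path (hop) distance in $\Gamma$. A graph $G$ on the same vertex set $V$ is viewed as edge-weighted: each edge $(u,v)$ of $G$ has weight $d_\Gamma(u,v)$, and $d_G(u,v)$ denotes the weighted shortest-path distance in $G$. For a set $S$ of non-edges of $G$, $G+S=(V,E(G)\cup S)$ with the same weighting rule. $G+S$ has dilation at most $t$ if $d_{G+S}(u,v)\le t\cdot d_\Gamma(u,v)$ for all $u,v\in V$. \textsc{Dilation $t$-Augmentation}: given $(G,\Gamma,k)$, decide whether there is a set $S$ of at most $k$ non-edges of $G$ such that $G+S$ has dilation at most $t$. *)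

theory Defs
  imports "HOL-Library.Extended_Nat" "HOL-Computational_Algebra.Polynomial"
begin

section \<open>Simple graphs and distances\<close>

text \<open>A finite simple undirected graph is a vertex set \<open>V\<close> together with a set \<open>E\<close> of
  two-element subsets of \<open>V\<close>.\<close>

definition vertex_pairs :: "'a set \<Rightarrow> 'a set set" where
  "vertex_pairs V = {{u, v} | u v. u \<in> V \<and> v \<in> V \<and> u \<noteq> v}"

definition fin_graph :: "'a set \<Rightarrow> 'a set set \<Rightarrow> bool" where
  "fin_graph V E \<longleftrightarrow> finite V \<and> E \<subseteq> vertex_pairs V"

definition non_edges :: "'a set \<Rightarrow> 'a set set \<Rightarrow> 'a set set" where
  "non_edges V E = vertex_pairs V - E"

definition simple_path :: "'a set \<Rightarrow> 'a set set \<Rightarrow> 'a list \<Rightarrow> bool" where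
  "simple_path V E p \<longleftrightarrow>
     p \<noteq> [] \<and> set p \<subseteq> V \<and> distinct p \<and> successively (\<lambda>u v. {u, v} \<in> E) p"

definition paths_between :: "'a set \<Rightarrow> 'a set set \<Rightarrow> 'a \<Rightarrow> 'a \<Rightarrow> 'a list set" where
  "paths_between V E u v = {p. simple_path V E p \<and> hd p = u \<and> last p = v}"

fun path_weight :: "('a \<Rightarrow> 'a \<Rightarrow> enat) \<Rightarrow> 'a list \<Rightarrow> enat" where
  "path_weight w (u # v # p) = w u v + path_weight w (v # p)"
| "path_weight w p = 0"

text \<open>Distances are \<open>\<infinity>\<close> between vertices in different components (infimum of the empty set).\<close>

definition weighted_dist :: "'a set \<Rightarrow> 'a set set \<Rightarrow> ('a \<Rightarrow> 'a \<Rightarrow> enat) \<Rightarrow> 'a \<Rightarrow> 'a \<Rightarrow> enat" where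
  "weighted_dist V E w u v = (INF p \<in> paths_between V E u v. path_weight w p)"

definition hop_dist :: "'a set \<Rightarrow> 'a set set \<Rightarrow> 'a \<Rightarrow> 'a \<Rightarrow> enat" where
  "hop_dist V E = weighted_dist V E (\<lambda>_ _. 1)"

definition connected_graph :: "'a set \<Rightarrow> 'a set set \<Rightarrow> bool" where
  "connected_graph V E \<longleftrightarrow> V \<noteq> {} \<and> (\<forall>u\<in>V. \<forall>v\<in>V. paths_between V E u v \<noteq> {})"

definition acyclic_graph :: "'a set \<Rightarrow> 'a set set \<Rightarrow> bool" where
  "acyclic_graph V E \<longleftrightarrow>
     \<not> (\<exists>p. simple_path V E p \<and> length p \<ge> 3 \<and> {last p, hd p} \<in> E)"

definition tree_graph :: "'a set \<Rightarrow> 'a set set \<Rightarrow> bool" where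
  "tree_graph V E \<longleftrightarrow> fin_graph V E \<and> connected_graph V E \<and> acyclic_graph V E"


section \<open>Dilation augmentation\<close>

text \<open>In the following, \<open>E\<close> and \<open>F\<close> are the edge sets of \<open>G\<close> and \<open>\<Gamma>\<close>.\<close>

definition dilation_at_most :: "nat \<Rightarrow> 'a set \<Rightarrow> 'a set set \<Rightarrow> 'a set set \<Rightarrow> bool" where
  "dilation_at_most t V E F \<longleftrightarrow>
     (\<forall>u\<in>V. \<forall>v\<in>V. weighted_dist V E (hop_dist V F) u v \<le> enat t * hop_dist V F u v)"

text \<open>An instance \<open>(n, E, F, k)\<close> has vertex set \<open>{..<n}\<close>.\<close>

type_synonym instance_t = "nat \<times> nat set set \<times> nat set set \<times> nat"

definition dilation_augmentation :: "nat \<Rightarrow> instance_t \<Rightarrow> bool" where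
  "dilation_augmentation t = (\<lambda>(n, E, F, k).
     \<exists>S. S \<subseteq> non_edges {..<n} E \<and> card S \<le> k \<and> dilation_at_most t {..<n} (E \<union> S) F)"

definition tree_instances :: "instance_t set" where
  "tree_instances = {(n, E, F, k). fin_graph {..<n} E \<and> tree_graph {..<n} F}"


section \<open>Deterministic multi-tape Turing machines\<close>

text \<open>States and tape symbols are natural numbers below \<open>num_states\<close> and \<open>num_symbols\<close>;
  symbol 0 is the blank and state 0 the initial state. Tapes are infinite in both directions.
  The transition function maps a state and the list of scanned symbols to a new state and, for
  each tape, the symbol to write and the head movement; its values outside the finite domain
  constrained by \<open>wf_tm\<close> are never used in a computation of a well-formed machine.\<close>

datatype move = Left | Stay | Right

record tm =
  num_tapes :: nat
  num_states :: nat
  num_symbols :: nat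
  accept_state :: nat
  reject_state :: nat
  trans :: "nat \<Rightarrow> nat list \<Rightarrow> nat \<times> (nat \<times> move) list"

definition wf_tm :: "tm \<Rightarrow> bool" where
  "wf_tm M \<longleftrightarrow>
     num_tapes M > 0 \<and> num_states M > 0 \<and> num_symbols M > 0 \<and>
     accept_state M < num_states M \<and> reject_state M < num_states M \<and>
     accept_state M \<noteq> reject_state M \<and>
     (\<forall>q<num_states M. \<forall>as. length as = num_tapes M \<and> (\<forall>a\<in>set as. a < num_symbols M) \<longrightarrow>
        (case trans M q as of (q', acts) \<Rightarrow>
           q' < num_states M \<and> length acts = num_tapes M \<and>
           (\<forall>(a, m)\<in>set acts. a < num_symbols M)))"

text \<open>A tape consists of its contents and the position of its head.\<close>

type_synonym tape = "(int \<Rightarrow> nat) \<times> int"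
type_synonym config = "nat \<times> tape list"

definition scanned :: "tape \<Rightarrow> nat" where
  "scanned T = fst T (snd T)"

fun move_offset :: "move \<Rightarrow> int" where
  "move_offset Left = -1"
| "move_offset Stay = 0"
| "move_offset Right = 1"

fun act :: "nat \<times> move \<Rightarrow> tape \<Rightarrow> tape" where
  "act (a, m) (c, h) = (c(h := a), h + move_offset m)"

definition halted :: "tm \<Rightarrow> config \<Rightarrow> bool" where
  "halted M C \<longleftrightarrow> fst C = accept_state M \<or> fst C = reject_state M"

definition step :: "tm \<Rightarrow> config \<Rightarrow> config" where
  "step M C =
     (if halted M C then C
      else (case trans M (fst C) (map scanned (snd C)) of
              (q, acts) \<Rightarrow> (q, map2 act acts (snd C))))"

definition blank_tape :: tape where
  "blank_tape = (\<lambda>_. 0, 0)"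

definition input_tape :: "nat list \<Rightarrow> tape" where
  "input_tape w = (\<lambda>i. if 0 \<le> i \<and> i < int (length w) then w ! nat i else 0, 0)"

definition initial_config :: "tm \<Rightarrow> nat list \<Rightarrow> config" where
  "initial_config M w = (0, input_tape w # replicate (num_tapes M - 1) blank_tape)"

definition run :: "tm \<Rightarrow> nat list \<Rightarrow> nat \<Rightarrow> config" where
  "run M w s = (step M ^^ s) (initial_config M w)"

text \<open>\<open>poly_time_solvable enc I P\<close>: one machine decides \<open>P\<close> on all encoded instances from \<open>I\<close>,
  in a number of steps polynomial in the length of the encoding.\<close>

definition poly_time_solvable :: "('i \<Rightarrow> nat list) \<Rightarrow> 'i set \<Rightarrow> ('i \<Rightarrow> bool) \<Rightarrow> bool" where
  "poly_time_solvable enc I P \<longleftrightarrow>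
     (\<exists>M (b :: nat poly). wf_tm M \<and>
        (\<forall>x\<in>I. set (enc x) \<subseteq> {1..<num_symbols M} \<and>
           (\<exists>s \<le> poly b (length (enc x)).
              fst (run M (enc x) s) = (if P x then accept_state M else reject_state M))))"


section \<open>Encoding of instances\<close>

text \<open>The bits 0 and 1 are written as the symbols 1 and 2, and 3 is a separator. A graph is given
  by its adjacency matrix, row by row, and \<open>k\<close> in binary, least significant bit first.\<close>

definition bit_symbol :: "bool \<Rightarrow> nat" where
  "bit_symbol b = (if b then 2 else 1)"

definition encode_graph :: "nat \<Rightarrow> nat set set \<Rightarrow> nat list" where
  "encode_graph n E = [bit_symbol ({i, j} \<in> E). i \<leftarrow> [0..<n], j \<leftarrow> [0..<n]]"

fun encode_nat :: "nat \<Rightarrow> nat list" where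
  "encode_nat k = (if k = 0 then [] else bit_symbol (odd k) # encode_nat (k div 2))"

declare encode_nat.simps [simp del]

definition encode_instance :: "instance_t \<Rightarrow> nat list" where
  "encode_instance = (\<lambda>(n, E, F, k).
     encode_graph n E @ [3] @ encode_graph n F @ [3] @ encode_nat k)"

end

theory Submission
  imports Defs
begin

text \<open>A weight-\<open>2\<close> detour around an edge of \<open>\<Gamma>\<close> would close a triangle in \<open>\<Gamma>\<close>, so if \<open>\<Gamma>\<close> is a
  tree then \<open>G + S\<close> has dilation at most \<open>2\<close> iff it contains every edge of \<open>\<Gamma>\<close>. The
  question is therefore whether \<open>\<Gamma>\<close> has at most \<open>k\<close> edges that are not edges of \<open>G\<close>. A machine with
  two tapes decides this in quadratic time: it copies the matrix of \<open>G\<close> to the second tape, replaces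
  it by the indicator of \<open>E(\<Gamma>) - E(G)\<close> while reading the matrix of \<open>\<Gamma>\<close>, and then decrements the
  binary counter \<open>k\<close> once for every two marks (each edge occurs twice in a symmetric matrix).\<close>

section \<open>Dilation at most 2 over a tree\<close>

lemma path_weight_one: "p \<noteq> [] \<Longrightarrow> path_weight (\<lambda>_ _. 1) p = enat (length p - 1)"
proof (induction p rule: induct_list012)
  case (3 x y zs)
  then show ?case by (simp add: one_enat_def)
qed (auto simp: zero_enat_def)

lemma weighted_dist_less_iff:
  "weighted_dist V E w u v < c \<longleftrightarrow> (\<exists>p. simple_path V E p \<and> hd p = u \<and> last p = v \<and> path_weight w p < c)"
  unfolding weighted_dist_def paths_between_def INF_less_iff by blast

text \<open>A strict upper bound on an infimum is witnessed by a single path. Strictness also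
  absorbs the offset between the edges of a path and the vertices that \<open>length\<close>
  counts.\<close>

lemma hop_dist_less_iff:
  "hop_dist V E u v < enat c \<longleftrightarrow> (\<exists>p. simple_path V E p \<and> hd p = u \<and> last p = v \<and> length p \<le> c)"
proof -
  have "path_weight (\<lambda>_ _. 1) p < enat c \<longleftrightarrow> length p \<le> c" if "simple_path V E p" for p :: "'a list"
  proof -
    have "p \<noteq> []" using that by (simp add: simple_path_def)
    then show ?thesis by (cases p) (auto simp: path_weight_one Suc_le_eq)
  qed
  then show ?thesis
    unfolding hop_dist_def weighted_dist_less_iff by blast
qed

lemma hop_dist_ge_one:
  assumes "u \<noteq> v" shows "1 \<le> hop_dist V E u v"
proof (rule ccontr)
  assume "\<not> ?thesis"
  then have "hop_dist V E u v < enat 1" by (simp add: one_enat_def)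
  then obtain p where p: "simple_path V E p" "hd p = u" "last p = v" "length p \<le> 1"
    unfolding hop_dist_less_iff by blast
  then show False using assms by (cases p) (auto simp: simple_path_def)
qed

lemma hop_dist_edge:
  assumes "fin_graph V E" "{u, v} \<in> E"
  shows "hop_dist V E u v \<le> 1"
proof -
  have "u \<in> V" "v \<in> V" "u \<noteq> v"
    using assms by (auto simp: fin_graph_def vertex_pairs_def doubleton_eq_iff)
  then have "simple_path V E [u, v]" using assms by (simp add: simple_path_def)
  then have "hop_dist V E u v < enat 2"
    unfolding hop_dist_less_iff by (intro exI[of _ "[u, v]"]) auto
  then show ?thesis by (cases "hop_dist V E u v") (auto simp: one_enat_def)
qed

lemma hop_dist_le_one_imp_edge:
  assumes "u \<noteq> v" "hop_dist V E u v \<le> 1"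
  shows "{u, v} \<in> E"
proof -
  have "hop_dist V E u v < enat 2"
    using assms(2) by (cases "hop_dist V E u v") (auto simp: one_enat_def)
  then obtain p where p: "simple_path V E p" "hd p = u" "last p = v" "length p \<le> 2"
    unfolding hop_dist_less_iff by blast
  then obtain x xs where "p = x # xs" by (cases p) (auto simp: simple_path_def)
  with p assms(1) show ?thesis
    by (cases xs; cases "tl xs") (auto simp: simple_path_def split: if_splits)
qed

text \<open>Each edge of \<open>F\<close> has weight at most 1, so a path in \<open>F\<close> is a
  path in \<open>E\<close> that weighs no more than its number of edges.\<close>

lemma weighted_hop_dist_mono:
  assumes F: "fin_graph V F" and "F \<subseteq> E"
  shows "weighted_dist V E (hop_dist V F) u v \<le> hop_dist V F u v"
proof -
  have le: "path_weight (hop_dist V F) p \<le> path_weight (\<lambda>_ _. 1) p"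
    if "successively (\<lambda>u v. {u, v} \<in> F) p" for p
    using that
  proof (induction p rule: induct_list012)
    case (3 x y zs)
    then have "hop_dist V F x y \<le> 1" using hop_dist_edge[OF F] by simp
    with 3 show ?case by (simp add: add_mono)
  qed auto
  have path: "simple_path V E p" if "simple_path V F p" for p
    using that assms(2) unfolding simple_path_def by (auto elim: successively_mono)
  show ?thesis unfolding hop_dist_def
    \<comment> \<open>The right-hand distance is unfolded first, so that folding
      \<open>hop_dist\<close> back restores only the weight function. Both sides are then infima,
      compared path by path.\<close>
    apply (subst (2) weighted_dist_def)
    unfolding hop_dist_def[symmetric] weighted_dist_def
    apply (rule INF_mono)
    using le path by (auto simp: paths_between_def simple_path_def)
qed

text \<open>The dilation bound gives the ends of each edge of \<Gamma> a path of weight at most 2 in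
  \<open>E\<close>. Weights between distinct vertices are at least 1, so this path has at most two
  edges. If there are two, both have weight 1 and hence lie in \<Gamma>, against acyclicity.\<close>

lemma dilation_at_most_2_tree_iff:
  assumes T: "tree_graph V F"
  shows "dilation_at_most 2 V E F \<longleftrightarrow> F \<subseteq> E"
proof
  have F: "fin_graph V F" using T by (simp add: tree_graph_def)
  {
    assume "F \<subseteq> E"
    show "dilation_at_most 2 V E F"
      unfolding dilation_at_most_def
    proof (intro ballI)
      fix u v
      have "weighted_dist V E (hop_dist V F) u v \<le> 1 * hop_dist V F u v"
        using weighted_hop_dist_mono[OF F \<open>F \<subseteq> E\<close>] by simp
      also have "\<dots> \<le> enat 2 * hop_dist V F u v"
        by (intro mult_right_mono) (auto simp: one_enat_def)
      finally show "weighted_dist V E (hop_dist V F) u v \<le> enat 2 * hop_dist V F u v" .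
    qed
  }
  assume dil: "dilation_at_most 2 V E F"
  show "F \<subseteq> E"
  proof
    fix e assume "e \<in> F"
    then obtain u v where e: "e = {u, v}" and uv: "u \<in> V" "v \<in> V" "u \<noteq> v"
      using F by (auto simp: fin_graph_def vertex_pairs_def)
    have "weighted_dist V E (hop_dist V F) u v \<le> enat 2 * hop_dist V F u v"
      using dil uv by (simp add: dilation_at_most_def)
    also have "\<dots> \<le> enat 2 * 1"
      using hop_dist_edge[OF F] \<open>e \<in> F\<close> e by (intro mult_left_mono) auto
    \<comment> \<open>Only a strict bound turns the infimum into an actual path.\<close>
    also have "\<dots> < 3" by (simp add: numeral_eq_enat)
    finally obtain p where p: "simple_path V E p" "hd p = u" "last p = v"
        and w: "path_weight (hop_dist V F) p < 3"
      unfolding weighted_dist_less_iff by blast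
    from p uv obtain y xs where "p = u # y # xs"
      by (cases p; cases "tl p") (auto simp: simple_path_def)
    then have "u \<noteq> y" using p(1) by (simp add: simple_path_def)
    then have uy: "1 \<le> hop_dist V F u y" by (rule hop_dist_ge_one)
    show "e \<in> E"
    proof (cases xs)
      case Nil
      with p \<open>p = u # y # xs\<close> e show ?thesis by (simp add: simple_path_def)
    next
      case (Cons z zs)
      then have dist: "distinct (u # y # z # zs)" "set (u # y # z # zs) \<subseteq> V"
        using p(1) \<open>p = u # y # xs\<close> by (auto simp: simple_path_def)
      then have yz: "1 \<le> hop_dist V F y z" by (intro hop_dist_ge_one) auto
      have sum: "hop_dist V F u y + (hop_dist V F y z + path_weight (hop_dist V F) (z # zs)) < 3"
        using w \<open>p = u # y # xs\<close> Cons by simp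
      have "zs = []"
      proof (cases zs)
        case (Cons a as)
        then have "1 \<le> hop_dist V F z a" using dist by (intro hop_dist_ge_one) auto
        then have "1 \<le> path_weight (hop_dist V F) (z # zs)"
          using Cons by (simp add: add_increasing2)
        with uy yz have "1 + (1 + 1) \<le> hop_dist V F u y + (hop_dist V F y z + path_weight (hop_dist V F) (z # zs))"
          by (intro add_mono)
        then have "3 \<le> hop_dist V F u y + (hop_dist V F y z + path_weight (hop_dist V F) (z # zs))"
          by simp
        with sum show ?thesis by (simp add: leD)
      qed simp
      then have "z = v" using p(3) \<open>p = u # y # xs\<close> Cons by simp
      from sum \<open>zs = []\<close> uy yz have "hop_dist V F u y \<le> 1" "hop_dist V F y z \<le> 1"
        by (cases "hop_dist V F u y"; cases "hop_dist V F y z";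
            simp add: one_enat_def numeral_eq_enat)+
      then have "{u, y} \<in> F" "{y, z} \<in> F"
        using dist by (auto intro!: hop_dist_le_one_imp_edge)
      then have "simple_path V F [u, y, z]" using dist by (simp add: simple_path_def)
      moreover have "{last [u, y, z], hd [u, y, z]} \<in> F"
        using \<open>e \<in> F\<close> e \<open>z = v\<close> by (simp add: insert_commute)
      moreover have "length [u, y, z] \<ge> 3" by simp
      ultimately have "\<not> acyclic_graph V F" unfolding acyclic_graph_def by blast
      then show ?thesis using T by (simp add: tree_graph_def)
    qed
  qed
qed

lemma dilation_augmentation_2_tree_iff:
  assumes "tree_graph {..<n} F"
  shows "dilation_augmentation 2 (n, E, F, k) \<longleftrightarrow> card (F - E) \<le> k"
proof
  assume "dilation_augmentation 2 (n, E, F, k)"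
  then obtain S where S: "S \<subseteq> non_edges {..<n} E" "card S \<le> k" "F \<subseteq> E \<union> S"
    using dilation_at_most_2_tree_iff[OF assms] by (auto simp: dilation_augmentation_def)
  \<comment> \<open>An infinite set would have \<open>card\<close> 0, so the bound on
    \<open>card S\<close> has content only once \<open>S\<close> is known to be finite.\<close>
  have "vertex_pairs {..<n} \<subseteq> Pow {..<n}" by (auto simp: vertex_pairs_def)
  then have "finite S"
    using S(1) by (auto simp: non_edges_def intro: finite_subset[of _ "Pow {..<n}"])
  then have "card (F - E) \<le> card S" using S(3) by (intro card_mono) auto
  with S(2) show "card (F - E) \<le> k" by simp
next
  assume "card (F - E) \<le> k"
  moreover have "F - E \<subseteq> non_edges {..<n} E"
    using assms by (auto simp: tree_graph_def fin_graph_def non_edges_def)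
  ultimately show "dilation_augmentation 2 (n, E, F, k)"
    using dilation_at_most_2_tree_iff[OF assms, of "E \<union> (F - E)"]
    unfolding dilation_augmentation_def by blast
qed

section \<open>Tapes as pairs of lists\<close>

text \<open>The default 0 is the blank: a finite list stands for a half-tape that is blank beyond
  its end.\<close>

definition cell :: "nat list \<Rightarrow> nat \<Rightarrow> nat" where
  "cell xs i = (if i < length xs then xs ! i else 0)"

lemma cell_simps [simp]:
  "cell [] i = 0" "cell (x # xs) 0 = x" "cell (x # xs) (Suc i) = cell xs i"
  by (auto simp: cell_def)

lemma cell_Cons: "cell (x # xs) i = (if i = 0 then x else cell xs (i - 1))"
  by (cases i) auto

lemma cell_tl: "cell (tl xs) i = cell xs (Suc i)"
  by (cases xs) auto

text \<open>The head stands on the first cell of \<open>rs\<close>, and \<open>ls\<close> lists the cells to its left, nearest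
  first.\<close>

definition zipper :: "nat list \<Rightarrow> nat list \<Rightarrow> int \<Rightarrow> tape" where
  "zipper ls rs h = (\<lambda>i. if i < h then cell ls (nat (h - 1 - i)) else cell rs (nat (i - h)), h)"

lemma scanned_zipper [simp]: "scanned (zipper ls rs h) = cell rs 0"
  by (simp add: scanned_def zipper_def)

text \<open>Phrased with \<open>tl\<close> and \<open>cell ls 0\<close> instead of a case split, the
  rules also cover a head that leaves the listed cells and meets blanks.\<close>

lemma act_zipper [simp]:
  "act (a, Stay) (zipper ls rs h) = zipper ls (a # tl rs) h"
  "act (a, Right) (zipper ls rs h) = zipper (a # ls) (tl rs) (h + 1)"
  "act (a, Left) (zipper ls rs h) = zipper (tl ls) (cell ls 0 # a # tl rs) (h - 1)"
proof -
  show "act (a, Stay) (zipper ls rs h) = zipper ls (a # tl rs) h"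
    by (auto simp: zipper_def cell_Cons cell_tl fun_eq_iff)
  show "act (a, Right) (zipper ls rs h) = zipper (a # ls) (tl rs) (h + 1)"
    by (auto simp: zipper_def cell_Cons cell_tl fun_eq_iff intro!: arg_cong[of _ _ "cell rs"]
        arg_cong[of _ _ "cell ls"])
  show "act (a, Left) (zipper ls rs h) = zipper (tl ls) (cell ls 0 # a # tl rs) (h - 1)"
    by (auto simp: zipper_def cell_Cons cell_tl fun_eq_iff intro!: arg_cong[of _ _ "cell rs"]
        arg_cong[of _ _ "cell ls"])
qed

text \<open>Blanks at the far end of a list do not change the tape. This form serves the end of the
  rewind, where the blank left of the copied matrix is crossed.\<close>

lemma zipper_blank_left [simp]: "zipper [0] rs h = zipper [] rs h"
  by (auto simp: zipper_def cell_Cons fun_eq_iff)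

lemma zipper_rewrite [simp]: "zipper ls (cell rs 0 # tl rs) h = zipper ls rs h"
  by (auto simp: zipper_def cell_Cons cell_tl fun_eq_iff)

lemma zipper_blank: "blank_tape = zipper [] [] 0"
  by (auto simp: zipper_def blank_tape_def fun_eq_iff)

lemma zipper_input: "input_tape w = zipper [] w 0"
  by (auto simp: zipper_def input_tape_def fun_eq_iff cell_def)

text \<open>\<open>t\<close> bounds the number of steps instead of fixing it, so that the costs of
  phases can be estimated generously and added up.\<close>

definition reaches :: "tm \<Rightarrow> nat \<Rightarrow> config \<Rightarrow> config \<Rightarrow> bool" where
  "reaches M t C C' \<longleftrightarrow> (\<exists>s\<le>t. (step M ^^ s) C = C')"

lemma reaches_refl [simp]: "reaches M t C C"
  unfolding reaches_def by (intro exI[of _ 0]) simp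

lemma reaches_mono: "reaches M t C C' \<Longrightarrow> t \<le> t' \<Longrightarrow> reaches M t' C C'"
  unfolding reaches_def by (auto intro: order_trans)

lemma reaches_trans [trans]:
  assumes "reaches M t C C'" "reaches M t' C' C''"
  shows "reaches M (t + t') C C''"
proof -
  from assms obtain s s' where "s \<le> t" "(step M ^^ s) C = C'" "s' \<le> t'" "(step M ^^ s') C' = C''"
    by (auto simp: reaches_def)
  then show ?thesis unfolding reaches_def
    by (intro exI[of _ "s' + s"]) (auto simp: funpow_add)
qed

lemma reaches_step:
  assumes "reaches M t (step M C) C'" shows "reaches M (Suc t) C C'"
proof -
  have "reaches M 1 C (step M C)" unfolding reaches_def by (intro exI[of _ 1]) simp
  from reaches_trans[OF this assms] show ?thesis by simp
qed

section \<open>The machine\<close>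

text \<open>State 0 copies the first matrix, 1 rewinds the copy, 2 overwrites it with the marks (symbol 2
  for an edge of \<open>\<Gamma>\<close> missing in \<open>G\<close>, symbol 1 otherwise). States 3 and 4 walk back over the
  marks, having seen an even and an odd number of them; 5 propagates the borrow of a decrement of
  the counter, and 6 returns to its least significant bit. States 7 and 8 are accepting and
  rejecting.\<close>

definition dil_trans :: "nat \<Rightarrow> nat list \<Rightarrow> nat \<times> (nat \<times> move) list" where
  "dil_trans q as = (let a = as ! 0; b = as ! 1 in
     if q = 0 then if a = 3 then (1, [(a, Stay), (b, Left)]) else (0, [(a, Right), (a, Right)])
     else if q = 1 then if b = 0 then (2, [(a, Right), (b, Right)]) else (1, [(a, Stay), (b, Left)])
     else if q = 2 then
       if a = 3 then (3, [(a, Right), (b, Left)])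
       else (2, [(a, Right), (if a = 2 \<and> b = 1 then 2 else 1, Right)])
     else if q = 3 then
       (if b = 0 then 7 else if b = 2 then 4 else 3, [(a, Stay), (b, Left)])
     else if q = 4 then
       (if b = 0 then 7 else if b = 2 then 5 else 4, [(a, Stay), (b, Left)])
     else if q = 5 then
       if a = 0 then (8, [(a, Stay), (b, Stay)])
       else if a = 1 then (5, [(2, Right), (b, Stay)])
       else (6, [(1, Stay), (b, Stay)])
     else if q = 6 then
       if a = 3 then (3, [(a, Right), (b, Stay)]) else (6, [(a, Left), (b, Stay)])
     else (8, [(a, Stay), (b, Stay)]))"

definition dil_tm :: tm where
  "dil_tm = \<lparr>num_tapes = 2, num_states = 9, num_symbols = 4, accept_state = 7, reject_state = 8,
     trans = dil_trans\<rparr>"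

lemma wf_dil_tm: "wf_tm dil_tm"
proof -
  have "case dil_trans q as of (q', acts) \<Rightarrow>
      q' < 9 \<and> length acts = 2 \<and> (\<forall>(a, m)\<in>set acts. a < 4)"
    if "length as = 2" "\<forall>a\<in>set as. a < 4" for q as
  proof -
    obtain a b where "as = [a, b]" using \<open>length as = 2\<close>
      by (auto simp: numeral_2_eq_2 length_Suc_conv)
    with that show ?thesis by (auto simp: dil_trans_def Let_def)
  qed
  then show ?thesis by (simp add: wf_tm_def dil_tm_def)
qed

section \<open>The phases that compute the marks\<close>

lemma step_dil_tm:
  "step dil_tm (q, [S, T]) =
     (if q = 7 \<or> q = 8 then (q, [S, T])
      else case dil_trans q [scanned S, scanned T] of (q, acts) \<Rightarrow> (q, map2 act acts [S, T]))"
  by (simp add: step_def halted_def dil_tm_def)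

lemmas dil_step = step_dil_tm dil_trans_def Let_def

text \<open>Symbols passed over pile up to the left of both heads, nearest first, so
  \<open>xs\<close> ends up reversed.\<close>

lemma copy_phase:
  assumes "set xs \<subseteq> {1, 2}"
  shows "reaches dil_tm (length xs) (0, [zipper ls (xs @ rs) h, zipper ls' [] h'])
     (0, [zipper (rev xs @ ls) rs (h + int (length xs)), zipper (rev xs @ ls') [] (h' + int (length xs))])"
  using assms
proof (induction xs arbitrary: ls ls' h h')
  case (Cons x xs)
  have "step dil_tm (0, [zipper ls ((x # xs) @ rs) h, zipper ls' [] h']) =
      (0, [zipper (x # ls) (xs @ rs) (h + 1), zipper (x # ls') [] (h' + 1)])"
    using Cons.prems by (auto simp: dil_step)
  with Cons.IH[of "x # ls" "h + 1" "x # ls'" "h' + 1"] Cons.prems show ?case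
    unfolding length_Cons by - (rule reaches_step, simp add: algebra_simps)
qed simp

text \<open>\<open>xs\<close> lists the cells still to be crossed, nearest first, and the head
  stands on the first of them. For empty \<open>xs\<close> it stands on the blank that stops the
  walk; the extra step turns around there.\<close>

lemma rewind_phase:
  assumes "set xs \<subseteq> {1, 2}"
  shows "\<exists>h' h''. reaches dil_tm (Suc (length xs))
     (1, [zipper ls (y # rs) h, zipper (tl xs) (cell xs 0 # zs) h0])
     (2, [zipper (y # ls) rs h', zipper [] (rev xs @ zs) h''])"
  using assms
proof (induction xs arbitrary: zs h0)
  case Nil
  have "step dil_tm (1, [zipper ls (y # rs) h, zipper (tl []) (cell [] 0 # zs) h0]) =
      (2, [zipper (y # ls) rs (h + 1), zipper [] zs (h0 + 1)])"
    by (simp add: dil_step)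
  then show ?case by (metis append_Nil list.size(3) reaches_refl reaches_step rev.simps(1))
next
  case (Cons x xs)
  have "step dil_tm (1, [zipper ls (y # rs) h, zipper (tl (x # xs)) (cell (x # xs) 0 # zs) h0]) =
      (1, [zipper ls (y # rs) h, zipper (tl xs) (cell xs 0 # x # zs) (h0 - 1)])"
    using Cons.prems by (auto simp: dil_step)
  moreover obtain h' h'' where "reaches dil_tm (Suc (length xs))
      (1, [zipper ls (y # rs) h, zipper (tl xs) (cell xs 0 # x # zs) (h0 - 1)])
      (2, [zipper (y # ls) rs h', zipper [] (rev xs @ x # zs) h''])"
    using Cons by (metis insert_subset list.simps(15))
  ultimately have "reaches dil_tm (Suc (length (x # xs)))
      (1, [zipper ls (y # rs) h, zipper (tl (x # xs)) (cell (x # xs) 0 # zs) h0])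
      (2, [zipper (y # ls) rs h', zipper [] (rev (x # xs) @ zs) h''])"
    unfolding length_Cons by - (rule reaches_step, simp)
  then show ?case by blast
qed

text \<open>Here \<open>a\<close> is the entry of \<open>G\<close> and \<open>b\<close> that of
  \<Gamma>, opposite to the scanned symbols in \<open>dil_trans\<close>, whose first tape shows
  \<Gamma> in state 2.\<close>

definition mark :: "nat \<Rightarrow> nat \<Rightarrow> nat" where
  "mark a b = (if b = 2 \<and> a = 1 then 2 else 1)"

lemma mark_phase:
  assumes "set ys \<subseteq> {1, 2}" "length xs = length ys"
  shows "\<exists>h1 h1'. reaches dil_tm (length xs) (2, [zipper ls (ys @ rs) h, zipper ls' xs h'])
     (2, [zipper (rev ys @ ls) rs h1, zipper (rev (map2 mark xs ys) @ ls') [] h1'])"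
  using assms(2,1)
proof (induction xs ys arbitrary: ls ls' h h' rule: list_induct2)
  case Nil
  show ?case by (intro exI[of _ h] exI[of _ h']) simp
next
  case (Cons x xs y ys)
  have "step dil_tm (2, [zipper ls ((y # ys) @ rs) h, zipper ls' (x # xs) h']) =
      (2, [zipper (y # ls) (ys @ rs) (h + 1), zipper (mark x y # ls') xs (h' + 1)])"
    using Cons.prems by (auto simp: dil_step mark_def)
  moreover obtain h1 h1' where "reaches dil_tm (length xs)
      (2, [zipper (y # ls) (ys @ rs) (h + 1), zipper (mark x y # ls') xs (h' + 1)])
      (2, [zipper (rev ys @ y # ls) rs h1, zipper (rev (map2 mark xs ys) @ mark x y # ls') [] h1'])"
    using Cons.IH[of "y # ls" "h + 1" "mark x y # ls'" "h' + 1"] Cons.prems by auto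
  ultimately have "reaches dil_tm (length (x # xs)) (2, [zipper ls ((y # ys) @ rs) h, zipper ls' (x # xs) h'])
      (2, [zipper (rev (y # ys) @ ls) rs h1, zipper (rev (map2 mark (x # xs) (y # ys)) @ ls') [] h1'])"
    unfolding length_Cons by - (rule reaches_step, simp)
  then show ?case by blast
qed

section \<open>The binary counter and its decrement\<close>

fun bin_value :: "nat list \<Rightarrow> nat" where
  "bin_value [] = 0"
| "bin_value (x # xs) = (if x = 2 then 1 else 0) + 2 * bin_value xs"

text \<open>\<open>bin_value\<close> also reads words whose most significant bits are zero; these
  arise because a decrement keeps the length of the counter.\<close>

lemma bin_value_encode_nat: "bin_value (encode_nat k) = k \<and> set (encode_nat k) \<subseteq> {1, 2}"
proof (induction k rule: encode_nat.induct)
  case (1 k)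
  then show ?case
    by (subst (1 2) encode_nat.simps) (auto simp: bit_symbol_def elim: oddE)
qed

text \<open>The separator before the counter stops the walk: \<open>length ds + 1\<close> moves to
  the left reach it, and one move to the right returns to the least significant bit.\<close>

lemma return_phase:
  assumes "set ds \<subseteq> {1, 2}" "x \<in> {1, 2}"
  shows "\<exists>h'. reaches dil_tm (length ds + 2)
     (6, [zipper (ds @ 3 # ls) (x # rs) h, zipper us vs g])
     (3, [zipper (3 # ls) (rev ds @ x # rs) h', zipper us vs g])"
  using assms
proof (induction ds arbitrary: x rs h)
  case Nil
  have "step dil_tm (6, [zipper ([] @ 3 # ls) (x # rs) h, zipper us vs g]) =
      (6, [zipper ls (3 # x # rs) (h - 1), zipper us vs g])"
    using Nil.prems by (auto simp: dil_step)
  moreover have "step dil_tm (6, [zipper ls (3 # x # rs) (h - 1), zipper us vs g]) =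
      (3, [zipper (3 # ls) (x # rs) h, zipper us vs g])"
    by (simp add: dil_step)
  ultimately have "reaches dil_tm (Suc (Suc 0)) (6, [zipper ([] @ 3 # ls) (x # rs) h, zipper us vs g])
      (3, [zipper (3 # ls) (rev [] @ x # rs) h, zipper us vs g])"
    by (intro reaches_step) simp
  then show ?case by (auto simp: numeral_2_eq_2)
next
  case (Cons d ds)
  have "step dil_tm (6, [zipper ((d # ds) @ 3 # ls) (x # rs) h, zipper us vs g]) =
      (6, [zipper (ds @ 3 # ls) (d # x # rs) (h - 1), zipper us vs g])"
    using Cons.prems by (auto simp: dil_step)
  moreover obtain h' where "reaches dil_tm (length ds + 2)
      (6, [zipper (ds @ 3 # ls) (d # x # rs) (h - 1), zipper us vs g])
      (3, [zipper (3 # ls) (rev ds @ d # x # rs) h', zipper us vs g])"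
    using Cons.IH[of d "x # rs" "h - 1"] Cons.prems by auto
  ultimately have "reaches dil_tm (length (d # ds) + 2)
      (6, [zipper ((d # ds) @ 3 # ls) (x # rs) h, zipper us vs g])
      (3, [zipper (3 # ls) (rev (d # ds) @ x # rs) h', zipper us vs g])"
    unfolding length_Cons add_Suc by - (rule reaches_step, simp)
  then show ?case by blast
qed

text \<open>The borrow turns the zero bits below the lowest one bit into ones and clears that bit;
  \<open>ds\<close> holds the bits already passed. If the lowest one bit has index \<open>j\<close>,
  then \<open>j + 1\<close> steps clear it and \<open>length ds + j + 2\<close> steps return, and
  \<open>j < length K\<close> gives the bound.\<close>

lemma decrement:
  assumes "set K \<subseteq> {1, 2}" "set ds \<subseteq> {1, 2}" "bin_value K > 0"
  shows "\<exists>K' h'. length K' = length K \<and> set K' \<subseteq> {1, 2} \<and> bin_value K = Suc (bin_value K') \<and>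
     reaches dil_tm (2 * length K + length ds + 1)
       (5, [zipper (ds @ 3 # ls) K h, zipper us vs g])
       (3, [zipper (3 # ls) (rev ds @ K') h', zipper us vs g])"
  using assms
proof (induction K arbitrary: ds h)
  case (Cons x K)
  show ?case
  proof (cases "x = 2")
    case True
    have "step dil_tm (5, [zipper (ds @ 3 # ls) (x # K) h, zipper us vs g]) =
        (6, [zipper (ds @ 3 # ls) (1 # K) h, zipper us vs g])"
      using True by (simp add: dil_step)
    moreover obtain h' where "reaches dil_tm (length ds + 2)
        (6, [zipper (ds @ 3 # ls) (1 # K) h, zipper us vs g])
        (3, [zipper (3 # ls) (rev ds @ 1 # K) h', zipper us vs g])"
      using return_phase[of ds 1 ls K h us vs g] Cons.prems by auto
    ultimately have "reaches dil_tm (Suc (length ds + 2))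
        (5, [zipper (ds @ 3 # ls) (x # K) h, zipper us vs g])
        (3, [zipper (3 # ls) (rev ds @ 1 # K) h', zipper us vs g])"
      by (intro reaches_step) simp
    then have "reaches dil_tm (2 * length (x # K) + length ds + 1)
        (5, [zipper (ds @ 3 # ls) (x # K) h, zipper us vs g])
        (3, [zipper (3 # ls) (rev ds @ 1 # K) h', zipper us vs g])"
      by (rule reaches_mono) simp
    with True Cons.prems show ?thesis
      by (intro exI[of _ "1 # K"] exI[of _ h']) auto
  next
    case False
    with Cons.prems have "x = 1" by auto
    have "step dil_tm (5, [zipper (ds @ 3 # ls) (x # K) h, zipper us vs g]) =
        (5, [zipper ((2 # ds) @ 3 # ls) K (h + 1), zipper us vs g])"
      using \<open>x = 1\<close> by (simp add: dil_step)
    moreover obtain K' h' where K': "length K' = length K" "set K' \<subseteq> {1, 2}"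
        "bin_value K = Suc (bin_value K')"
      and "reaches dil_tm (2 * length K + length (2 # ds) + 1)
        (5, [zipper ((2 # ds) @ 3 # ls) K (h + 1), zipper us vs g])
        (3, [zipper (3 # ls) (rev (2 # ds) @ K') h', zipper us vs g])"
      using Cons.IH[of "2 # ds" "h + 1"] Cons.prems \<open>x = 1\<close> by auto
    ultimately have "reaches dil_tm (Suc (2 * length K + length (2 # ds) + 1))
        (5, [zipper (ds @ 3 # ls) (x # K) h, zipper us vs g])
        (3, [zipper (3 # ls) (rev ds @ 2 # K') h', zipper us vs g])"
      by (intro reaches_step) simp
    with K' \<open>x = 1\<close> show ?thesis
      by (intro exI[of _ "2 # K'"] exI[of _ h']) auto
  qed
qed simp

text \<open>All bits are zero, so the borrow runs on to the blank after the counter, where the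
  machine rejects.\<close>

lemma underflow:
  assumes "set K \<subseteq> {1, 2}" "bin_value K = 0"
  shows "\<exists>C. reaches dil_tm (length K + 1) (5, [zipper ls K h, zipper us vs g]) C \<and> fst C = 8"
  using assms
proof (induction K arbitrary: ls h)
  case Nil
  have "fst (step dil_tm (5, [zipper ls [] h, zipper us vs g])) = 8"
    by (simp add: dil_step)
  then show ?case using reaches_step[OF reaches_refl] by fastforce
next
  case (Cons x K)
  have "step dil_tm (5, [zipper ls (x # K) h, zipper us vs g]) =
      (5, [zipper (2 # ls) K (h + 1), zipper us vs g])"
    using Cons.prems by (auto simp: dil_step split: if_splits)
  moreover obtain C where "reaches dil_tm (length K + 1) (5, [zipper (2 # ls) K (h + 1), zipper us vs g]) C"
      "fst C = 8"
    using Cons.IH[of "2 # ls" "h + 1"] Cons.prems by auto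
  ultimately show ?case
    unfolding length_Cons add_Suc using reaches_step by metis
qed

text \<open>\<open>q - 3\<close> counts the mark that still waits for its partner, so the quotient
  by 2 is the number of decrements to come. The run accepts iff the counter survives all of them.
  The additional cell in the time bound is the blank at which the walk ends.\<close>

lemma countdown:
  assumes "set K \<subseteq> {1, 2}" "set ds \<subseteq> {1, 2}" "q = 3 \<or> q = 4"
  shows "\<exists>C. reaches dil_tm ((length ds + 1) * (2 * length K + 3))
       (q, [zipper (3 # ls) K h, zipper (tl ds) (cell ds 0 # rs) g]) C \<and>
     fst C = (if (count_list ds 2 + (q - 3)) div 2 \<le> bin_value K then 7 else 8)"
  using assms
proof (induction ds arbitrary: K q h rs g)
  case Nil
  have "fst (step dil_tm (q, [zipper (3 # ls) K h, zipper (tl []) (cell [] 0 # rs) g])) = 7"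
    using Nil.prems by (auto simp: dil_step)
  moreover have "reaches dil_tm (Suc (2 * length K + 2)) (q, [zipper (3 # ls) K h, zipper (tl []) (cell [] 0 # rs) g])
     (step dil_tm (q, [zipper (3 # ls) K h, zipper (tl []) (cell [] 0 # rs) g]))"
    by (rule reaches_step) simp
  ultimately show ?case using Nil.prems
    by (intro exI[of _ "step dil_tm (q, [zipper (3 # ls) K h, zipper (tl []) (cell [] 0 # rs) g])"])
      (auto simp: eval_nat_numeral)
next
  case (Cons d ds)
  let ?C = "(q, [zipper (3 # ls) K h, zipper (tl (d # ds)) (cell (d # ds) 0 # rs) g])"
  let ?T = "zipper (tl ds) (cell ds 0 # d # rs) (g - 1)"
  \<comment> \<open>A mark advances 3 to 4 and 4 to 5, where a decrement is due; any other cell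
    keeps the state.\<close>
  define q' where "q' = (if d = 2 then Suc q else q)"
  have st: "step dil_tm ?C = (q', [zipper (3 # ls) K h, ?T])"
  proof -
    have "d = 1 \<or> d = 2" using Cons.prems(2) by auto
    with Cons.prems(3) show ?thesis by (elim disjE) (simp_all add: dil_step q'_def)
  qed
  \<comment> \<open>One more cell enlarges the budget by \<open>2 * length K + 3\<close>, enough for
    the walking step and a decrement.\<close>
  have bound: "Suc ((length ds + 1) * (2 * length K + 3) + 2 * length K + 1) \<le> (length (d # ds) + 1) * (2 * length K + 3)"
    by simp
  show ?case
  proof (cases "q' = 5")
    case False
    then have "q' = 3 \<or> q' = 4" using Cons.prems by (auto simp: q'_def)
    with Cons obtain C where C: "reaches dil_tm ((length ds + 1) * (2 * length K + 3)) (q', [zipper (3 # ls) K h, ?T]) C"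
      "fst C = (if (count_list ds 2 + (q' - 3)) div 2 \<le> bin_value K then 7 else 8)"
      by (metis insert_subset list.simps(15))
    have "reaches dil_tm ((length (d # ds) + 1) * (2 * length K + 3)) ?C C"
      by (rule reaches_mono[OF reaches_step _]) (use C st bound in auto)
    moreover have "count_list ds 2 + (q' - 3) = count_list (d # ds) 2 + (q - 3)"
      using Cons.prems by (auto simp: q'_def)
    ultimately show ?thesis using C(2) by metis
  next
    case True
    then have q: "q = 4" "d = 2" using Cons.prems by (auto simp: q'_def split: if_splits)
    show ?thesis
    proof (cases "bin_value K = 0")
      \<comment> \<open>At least one pair of marks is still to be paid for with an empty counter, so
        rejection is correct.\<close>
      case zero: True
      obtain C where C: "reaches dil_tm (length K + 1) (5, [zipper (3 # ls) K h, ?T]) C" "fst C = 8"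
        using underflow[OF Cons.prems(1) zero] by blast
      have "reaches dil_tm ((length (d # ds) + 1) * (2 * length K + 3)) ?C C"
      proof (rule reaches_mono[OF reaches_step])
        have "Suc (length K + 1) \<le> Suc (m + 2 * length K + 1)" for m by simp
        with bound show "Suc (length K + 1) \<le> (length (d # ds) + 1) * (2 * length K + 3)"
          by (rule order_trans[rotated])
      qed (use C st True in simp)
      with C(2) show ?thesis using q zero by (intro exI[of _ C]) simp
    next
      case pos: False
      then obtain K' h' where K': "length K' = length K" "set K' \<subseteq> {1, 2}"
          "bin_value K = Suc (bin_value K')"
        and dec: "reaches dil_tm (2 * length K + 1) (5, [zipper (3 # ls) K h, ?T])
            (3, [zipper (3 # ls) K' h', ?T])"
        using decrement[of K "[]" ls h "tl ds" "cell ds 0 # d # rs" "g - 1"] Cons.prems pos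
        by (auto simp del: One_nat_def)
      \<comment> \<open>The walk resumes in state 3 with no mark pending, and since
        \<open>K'\<close> is as long as \<open>K\<close> the cost per cell stays the same.\<close>
      obtain C where C: "reaches dil_tm ((length ds + 1) * (2 * length K' + 3)) (3, [zipper (3 # ls) K' h', ?T]) C"
        "fst C = (if (count_list ds 2 + (3 - 3)) div 2 \<le> bin_value K' then 7 else 8)"
        using Cons.IH[of K' 3 h' "d # rs" "g - 1"] K' Cons.prems by auto
      have "reaches dil_tm (2 * length K + 1 + (length ds + 1) * (2 * length K' + 3))
          (5, [zipper (3 # ls) K h, ?T]) C"
        using dec C(1) by (rule reaches_trans)
      then have "reaches dil_tm ((length (d # ds) + 1) * (2 * length K + 3)) ?C C"
        by (intro reaches_mono[OF reaches_step bound]) (use st True K' in \<open>simp add: add_ac\<close>)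
      with C(2) show ?thesis using q K' by (intro exI[of _ C]) simp
    qed
  qed
qed

text \<open>\<open>3 * length A + 3\<close> pays for copying, rewinding and marking plus one step
  for each of the three turns of the second head; the product pays for the countdown.\<close>

lemma dil_tm_run:
  assumes "set A \<subseteq> {1, 2}" "set B \<subseteq> {1, 2}" "set K \<subseteq> {1, 2}" "length A = length B"
  shows "\<exists>C. reaches dil_tm (3 * length A + 3 + (length A + 1) * (2 * length K + 3))
       (initial_config dil_tm (A @ 3 # B @ 3 # K)) C \<and>
     fst C = (if count_list (map2 mark A B) 2 div 2 \<le> bin_value K then 7 else 8)"
proof -
  \<comment> \<open>The marks are read back from right to left.\<close>
  define D where "D = rev (map2 mark A B)"
  have D: "length D = length A" "set D \<subseteq> {1, 2}" "count_list D 2 = count_list (map2 mark A B) 2"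
    using assms(4) by (auto simp: D_def mark_def split: if_splits)
  have "initial_config dil_tm (A @ 3 # B @ 3 # K) = (0, [zipper [] (A @ 3 # B @ 3 # K) 0, zipper [] [] 0])"
    by (simp add: initial_config_def zipper_blank zipper_input dil_tm_def)
  then have "reaches dil_tm (length A) (initial_config dil_tm (A @ 3 # B @ 3 # K))
      (0, [zipper (rev A) (3 # B @ 3 # K) (int (length A)), zipper (rev A) [] (int (length A))])"
    using copy_phase[OF assms(1), of "[]" "3 # B @ 3 # K" 0 "[]" 0] by simp
  also have "reaches dil_tm 1 (0, [zipper (rev A) (3 # B @ 3 # K) (int (length A)), zipper (rev A) [] (int (length A))])
      (1, [zipper (rev A) (3 # B @ 3 # K) (int (length A)), zipper (tl (rev A)) (cell (rev A) 0 # [0]) (int (length A) - 1)])"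
    unfolding One_nat_def by (rule reaches_step) (simp add: dil_step)
  also obtain h h' where "reaches dil_tm (Suc (length (rev A)))
      (1, [zipper (rev A) (3 # B @ 3 # K) (int (length A)), zipper (tl (rev A)) (cell (rev A) 0 # [0]) (int (length A) - 1)])
      (2, [zipper (3 # rev A) (B @ 3 # K) h, zipper [] (rev (rev A) @ [0]) h'])"
    using rewind_phase[of "rev A"] assms(1) by fastforce
  finally have *: "reaches dil_tm (2 * length A + 2) (initial_config dil_tm (A @ 3 # B @ 3 # K))
      (2, [zipper (3 # rev A) (B @ 3 # K) h, zipper [] (A @ [0]) h'])"
    by (simp add: mult_2)
  \<comment> \<open>The blank written at the first turn is dropped, since \<open>mark_phase\<close>
    needs lists of equal length.\<close>
  have "zipper [] (A @ [0]) h' = zipper [] A h'"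
    by (auto simp: zipper_def cell_def fun_eq_iff nth_append)
  with * have "reaches dil_tm (2 * length A + 2) (initial_config dil_tm (A @ 3 # B @ 3 # K))
      (2, [zipper (3 # rev A) (B @ 3 # K) h, zipper [] A h'])"
    by simp
  also obtain h1 h1' where "reaches dil_tm (length A)
      (2, [zipper (3 # rev A) (B @ 3 # K) h, zipper [] A h'])
      (2, [zipper (rev B @ 3 # rev A) (3 # K) h1, zipper D [] h1'])"
    using mark_phase[OF assms(2,4), of "3 # rev A" "3 # K" h "[]" h'] by (auto simp: D_def)
  also have "reaches dil_tm 1 (2, [zipper (rev B @ 3 # rev A) (3 # K) h1, zipper D [] h1'])
      (3, [zipper (3 # rev B @ 3 # rev A) K (h1 + 1), zipper (tl D) (cell D 0 # [0]) (h1' - 1)])"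
    unfolding One_nat_def by (rule reaches_step) (simp add: dil_step)
  finally have *: "reaches dil_tm (3 * length A + 3) (initial_config dil_tm (A @ 3 # B @ 3 # K))
      (3, [zipper (3 # rev B @ 3 # rev A) K (h1 + 1), zipper (tl D) (cell D 0 # [0]) (h1' - 1)])"
    by (rule reaches_mono) simp
  obtain C where "reaches dil_tm ((length D + 1) * (2 * length K + 3))
      (3, [zipper (3 # rev B @ 3 # rev A) K (h1 + 1), zipper (tl D) (cell D 0 # [0]) (h1' - 1)]) C"
      and C: "fst C = (if (count_list D 2 + (3 - 3)) div 2 \<le> bin_value K then 7 else 8)"
    using countdown[OF assms(3) D(2), of 3] by blast
  from reaches_trans[OF * this(1)] have "reaches dil_tm (3 * length A + 3 + (length A + 1) * (2 * length K + 3))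
      (initial_config dil_tm (A @ 3 # B @ 3 # K)) C"
    by (simp only: D)
  with C D show ?thesis by (intro exI[of _ C]) simp
qed

section \<open>Counting marks\<close>

text \<open>The ends of an edge are distinct, so each fibre of the map from ordered pairs to edges
  has two elements.\<close>

lemma card_ordered_pairs:
  assumes "X \<subseteq> vertex_pairs V" "finite V"
  shows "card {(u, v). {u, v} \<in> X} = 2 * card X"
proof -
  have "vertex_pairs V \<subseteq> Pow V" by (auto simp: vertex_pairs_def)
  then have fin: "finite X" using assms by (meson finite_Pow_iff finite_subset)
  have two: "finite {(u, v). {u, v} = e} \<and> card {(u, v). {u, v} = e} = 2" if "e \<in> X" for e
  proof -
    obtain a b where "e = {a, b}" "a \<noteq> b"
      using assms(1) \<open>e \<in> X\<close> by (auto simp: vertex_pairs_def)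
    then have "{(u, v). {u, v} = e} = {(a, b), (b, a)}" by (auto simp: doubleton_eq_iff)
    with \<open>a \<noteq> b\<close> show ?thesis by simp
  qed
  have "{(u, v). {u, v} \<in> X} = (\<Union>e\<in>X. {(u, v). {u, v} = e})" by auto
  also have "card \<dots> = (\<Sum>e\<in>X. card {(u, v). {u, v} = e})"
    using fin two by (intro card_UN_disjoint) auto
  also have "\<dots> = 2 * card X" using two by simp
  finally show ?thesis .
qed

text \<open>As maps over one common list of index pairs, two matrices can be zipped entry by
  entry.\<close>

lemma encode_graph_eq_map:
  "encode_graph n E = map (\<lambda>(i, j). bit_symbol ({i, j} \<in> E)) (List.product [0..<n] [0..<n])"
  by (simp add: encode_graph_def product_concat_map map_concat comp_def)

lemma count_list_map_eq_card:
  assumes "distinct xs"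
  shows "count_list (map f xs) y = card {x \<in> set xs. f x = y}"
proof -
  have "count_list (map f xs) y = length (filter (\<lambda>x. f x = y) xs)"
    by (induction xs) auto
  also have "\<dots> = card (set (filter (\<lambda>x. f x = y) xs))"
    using assms by (intro distinct_card[symmetric]) simp
  finally show ?thesis by simp
qed

lemma count_marks:
  assumes "F \<subseteq> vertex_pairs {..<n}"
  shows "count_list (map2 mark (encode_graph n E) (encode_graph n F)) 2 = 2 * card (F - E)"
proof -
  have "map2 mark (encode_graph n E) (encode_graph n F) =
      map (\<lambda>(i, j). if {i, j} \<in> F - E then 2 else 1) (List.product [0..<n] [0..<n])"
    by (auto simp: encode_graph_eq_map zip_map_map zip_same_conv_map mark_def bit_symbol_def)
  then have "count_list (map2 mark (encode_graph n E) (encode_graph n F)) 2 =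
      card {p \<in> set (List.product [0..<n] [0..<n]). (case p of (i, j) \<Rightarrow> if {i, j} \<in> F - E then 2 else 1) = (2 :: nat)}"
    by (simp only:) (rule count_list_map_eq_card, simp add: distinct_product)
  \<comment> \<open>The ends of edges in \<open>F\<close> lie below \<open>n\<close>, so confining
    the pairs to the index range loses nothing.\<close>
  also have "{p \<in> set (List.product [0..<n] [0..<n]). (case p of (i, j) \<Rightarrow> if {i, j} \<in> F - E then 2 else 1) = (2 :: nat)} =
      {(u, v). {u, v} \<in> F - E}"
    using assms by (auto simp: vertex_pairs_def doubleton_eq_iff split: if_splits)
  also have "card \<dots> = 2 * card (F - E)"
    using assms by (intro card_ordered_pairs[of _ "{..<n}"]) auto
  finally show ?thesis .
qed

section \<open>Correctness of the machine and its polynomial time bound\<close>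

theorem theorem36:
  shows "poly_time_solvable encode_instance tree_instances (dilation_augmentation 2)"
  unfolding poly_time_solvable_def
\<comment> \<open>For an input of length \<open>N\<close> the polynomial is
  \<open>3 * N + 2 * N^2\<close>: the linear term covers the phases up to the marks, the square the
  countdown.\<close>
proof (intro exI[of _ dil_tm] exI[of _ "[:0, 3, 2:]"] conjI ballI)
  show "wf_tm dil_tm" by (rule wf_dil_tm)
  fix x assume "x \<in> tree_instances"
  then obtain n E F k where x: "x = (n, E, F, k)" and T: "tree_graph {..<n} F"
    by (auto simp: tree_instances_def)
  define A B K where "A = encode_graph n E" and "B = encode_graph n F" and "K = encode_nat k"
  have enc: "encode_instance x = A @ 3 # B @ 3 # K"
    by (simp add: x encode_instance_def A_def B_def K_def)
  have sets: "set A \<subseteq> {1, 2}" "set B \<subseteq> {1, 2}" "set K \<subseteq> {1, 2}"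
    using bin_value_encode_nat[of k]
    by (auto simp: A_def B_def K_def encode_graph_eq_map bit_symbol_def split: if_splits)
  then show "set (encode_instance x) \<subseteq> {1..<num_symbols dil_tm}"
    unfolding enc by (auto simp: dil_tm_def)
  have len: "length A = length B" by (simp add: A_def B_def encode_graph_eq_map)
  have "count_list (map2 mark A B) 2 = 2 * card (F - E)"
    using T unfolding A_def B_def by (intro count_marks) (simp add: tree_graph_def fin_graph_def)
  moreover have "bin_value K = k" using bin_value_encode_nat by (simp add: K_def)
  ultimately obtain C where C: "reaches dil_tm (3 * length A + 3 + (length A + 1) * (2 * length K + 3))
       (initial_config dil_tm (encode_instance x)) C" "fst C = (if card (F - E) \<le> k then 7 else 8)"
    using dil_tm_run[OF sets len] enc by auto
  let ?N = "length (encode_instance x)"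
  \<comment> \<open>The two separators in the encoding make room for the constants:
    \<open>?N\<close> is at least \<open>length A + 1\<close> and at least
    \<open>length K + 2\<close>.\<close>
  have "(length A + 1) * (2 * length K + 3) \<le> ?N * (2 * ?N)"
    unfolding enc by (intro mult_mono) auto
  moreover have "3 * length A + 3 \<le> 3 * ?N" by (simp add: enc)
  moreover have "poly [:0, 3, 2:] ?N = 3 * ?N + ?N * (2 * ?N)" by (simp add: algebra_simps)
  ultimately have "3 * length A + 3 + (length A + 1) * (2 * length K + 3) \<le> poly [:0, 3, 2:] ?N"
    by linarith
  with C(1) have "reaches dil_tm (poly [:0, 3, 2:] ?N) (initial_config dil_tm (encode_instance x)) C"
    by (rule reaches_mono)
  then obtain s where "s \<le> poly [:0, 3, 2:] ?N" "run dil_tm (encode_instance x) s = C"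
    by (auto simp: reaches_def run_def)
  moreover have "fst C = (if dilation_augmentation 2 x then accept_state dil_tm else reject_state dil_tm)"
    using C(2) by (simp add: x dilation_augmentation_2_tree_iff[OF T] dil_tm_def)
  ultimately show "\<exists>s\<le>poly [:0, 3, 2:] ?N. fst (run dil_tm (encode_instance x) s) =
      (if dilation_augmentation 2 x then accept_state dil_tm else reject_state dil_tm)"
    by blast
qed

end
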